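(* For each integer $n\ge 0$ let $$R_n(q)=1-(1-q)^n\sum_{m=0}^{n-1}\binom{n+m-1}{m}q^m+q^n\sum_{m=0}^{n-1}\binom{n+m-1}{m}(1-q)^m .$$ Then the polynomials $R_n(q)$ satisfy the initial conditions $R_0(q)=1$, $R_1(q)=2q$, and for every integer $n\ge 2$ $$R_n(q)=-\frac{4nq^2-4qn-6q^2-n+6q+1}{n-1}\,R_{n-1}(q)+\frac{2q(q-1)(2n-3)}{n-1}\,R_{n-2}(q).$$
   Context: Empty sums are $0$, so $R_0(q)=1$. Background on the meaning of $R_n(q)$ (the "Rosenfeld polynomial"): teams G and B play, each goal being independently scored by B with probability $q$ ($0<q<1/2$) and by G with probability $1-q$. Phase I lasts until G has scored $n$ goals. If B has then scored at least $n$ goals, B wins immediately; otherwise they continue (Phase II) and B wins if and only if the score is eventually tied. $R_n(q)$ is the probability that B wins. *)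

theory Defs
  imports Complex_Main "HOL-Computational_Algebra.Polynomial"
begin

text \<open>The indeterminate \<open>q\<close> of the polynomials is written \<open>X\<close>.\<close>

abbreviation X :: "real poly" where
  "X \<equiv> [:0, 1:]"

text \<open>
  The truncated subtraction \<open>n + m - 1\<close> is harmless: the sums range over \<open>m < n\<close>, so they are
  empty for \<open>n = 0\<close>, and \<open>n + m \<ge> 1\<close> otherwise.
\<close>

definition rosenfeld_poly :: "nat \<Rightarrow> real poly" where
  "rosenfeld_poly n =
     1 - (1 - X) ^ n * (\<Sum>m<n. of_nat ((n + m - 1) choose m) * X ^ m)
       + X ^ n * (\<Sum>m<n. of_nat ((n + m - 1) choose m) * (1 - X) ^ m)"

end

theory Submission
  imports Defs
begin

text \<open>
  Put \<open>p = 1 - q\<close>. Pascal's rule shows that raising \<open>n\<close> to \<open>n + 1\<close> changes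
  \<open>p ^ n * (\<Sum>m<n. ((n + m - 1) choose m) * q ^ m)\<close> by
  \<open>((2 * n - 1) choose n) * (p * q) ^ n * (p - q)\<close>. Subtracting the same identity with \<open>p\<close> and
  \<open>q\<close> exchanged gives \<open>R (n + 1) - R n = - ((2 * n) choose n) * (p * q) ^ n * (1 - 2 * q)\<close>, and
  the claimed recurrence is the one that the central binomial coefficients induce on these
  differences.
\<close>

text \<open>Multiplying by x = 1 - y takes differences of consecutive coefficients, and Pascal's
  rule turns these into the coefficients for \<open>n\<close>; truncation at \<open>k\<close> leaves
  one boundary term. This is a finite form of (1 - y) * (1 - y)^(-n-2) = (1 - y)^(-n-1).\<close>

lemma sum_choose_times_power:
  fixes x y :: "'a::comm_ring_1"
  assumes "x + y = 1"
  shows "x * (\<Sum>m\<le>k. of_nat ((Suc n + m) choose m) * y ^ m) =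
    (\<Sum>m\<le>k. of_nat ((n + m) choose m) * y ^ m) - of_nat ((Suc n + k) choose k) * y ^ Suc k"
proof (induction k)
  case 0
  show ?case using assms by (simp add: algebra_simps)
next
  case (Suc k)
  have x: "x = 1 - y" using assms by (simp add: algebra_simps)
  have pascal: "(of_nat ((Suc n + Suc k) choose Suc k) :: 'a) =
      of_nat ((n + Suc k) choose Suc k) + of_nat ((Suc n + k) choose k)"
    by simp
  show ?case
    unfolding sum.atMost_Suc distrib_left Suc.IH pascal
    unfolding x by (simp add: algebra_simps)
qed

lemma central_binomial_half:
  "(2 * Suc n) choose Suc n = 2 * ((Suc n + n) choose Suc n)"
proof -
  have "(Suc n + n) choose n = (Suc n + n) choose Suc n"
    by (subst binomial_symmetric) auto
  then show ?thesis by (simp add: mult_2)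
qed

text \<open>One factor \<open>x\<close> is absorbed by \<open>sum_choose_times_power\<close>. Left
  over are the top summand, with coefficient \<open>?c\<close>, and the boundary term, with
  coefficient 2 * \<open>?c\<close>; together they give the factor 1 - 2 * y = x - y. Starting at
  \<open>Suc n\<close> avoids truncated subtraction.\<close>

lemma power_times_sum_choose_Suc:
  fixes x y :: "'a::comm_ring_1"
  assumes "x + y = 1"
  shows "x ^ Suc (Suc n) * (\<Sum>m<Suc (Suc n). of_nat ((Suc n + m) choose m) * y ^ m) =
    x ^ Suc n * (\<Sum>m<Suc n. of_nat ((n + m) choose m) * y ^ m) +
    of_nat ((Suc n + n) choose Suc n) * (x * y) ^ Suc n * (x - y)"
proof -
  let ?c = "of_nat ((Suc n + n) choose Suc n) :: 'a"
  have x: "x = 1 - y" using assms by (simp add: algebra_simps)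
  have cs: "(of_nat ((Suc n + Suc n) choose Suc n) :: 'a) = 2 * ?c"
    using central_binomial_half[of n] by (simp only: mult_2 of_nat_add)
  have cn: "of_nat ((n + Suc n) choose Suc n) = ?c"
    by (simp add: add.commute)
  have "x ^ Suc (Suc n) * (\<Sum>m<Suc (Suc n). of_nat ((Suc n + m) choose m) * y ^ m) =
      x ^ Suc n * (x * (\<Sum>m\<le>Suc n. of_nat ((Suc n + m) choose m) * y ^ m))"
    by (simp only: lessThan_Suc_atMost power_Suc mult_ac)
  also have "\<dots> = x ^ Suc n * ((\<Sum>m<Suc n. of_nat ((n + m) choose m) * y ^ m)
      + ?c * y ^ Suc n - 2 * ?c * y ^ Suc (Suc n))"
    unfolding sum_choose_times_power[OF assms] cs
    by (simp only: sum.atMost_Suc lessThan_Suc_atMost cn)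
  also have "\<dots> = x ^ Suc n * (\<Sum>m<Suc n. of_nat ((n + m) choose m) * y ^ m)
      + ?c * (x ^ Suc n * y ^ Suc n) * (1 - 2 * y)"
    by (simp add: algebra_simps)
  also have "1 - 2 * y = x - y"
    unfolding x by simp
  finally show ?thesis by (simp only: power_mult_distrib)
qed

lemma rosenfeld_poly_diff:
  "rosenfeld_poly (Suc n) - rosenfeld_poly n =
    - (of_nat ((2 * n) choose n) * (X * (1 - X)) ^ n * (1 - 2 * X))"
proof (cases n)
  case 0
  then show ?thesis by (simp add: rosenfeld_poly_def numeral_poly)
next
  case (Suc k)
  have "(1 - X) + X = 1" "X + (1 - X) = 1"
    by simp_all
  note e = this[THEN power_times_sum_choose_Suc[of _ _ k]]
  have c: "(of_nat ((2 * Suc k) choose Suc k) :: real poly) =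
      2 * of_nat ((Suc k + k) choose Suc k)"
    unfolding central_binomial_half by simp
  have m: "Suc (Suc k) + m - 1 = Suc k + m" "Suc k + m - 1 = k + m" for m
    by simp_all
  \<comment> \<open>Here \<open>a\<close> and \<open>b\<close> are the two products at the lower
    index. Their increments have opposite signs and are subtracted, so they add up to the factor 2
    that completes the central binomial coefficient.\<close>
  have alg: "1 - (a + c * t * (p - q)) + (b + c * t * (q - p)) - (1 - a + b)
      = - (2 * c * t * (p - q))" for a b c t p q :: "real poly"
    by (simp add: algebra_simps)
  show ?thesis
    unfolding Suc rosenfeld_poly_def m e c mult.commute[of "1 - X" X] alg
    by (simp only: diff_diff_eq mult_2)
qed

lemma central_binomial_Suc:
  "Suc n * ((2 * Suc n) choose Suc n) = 2 * (2 * n + 1) * ((2 * n) choose n)"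
proof -
  have "Suc n + n = Suc (2 * n)" by simp
  then have "Suc n * ((Suc n + n) choose Suc n) = (2 * n + 1) * ((2 * n) choose n)"
    using Suc_times_binomial_eq[of "2 * n" n] by (simp only: mult.commute Suc_eq_plus1)
  then show ?thesis
    unfolding central_binomial_half by (simp only: mult.left_commute mult.assoc)
qed

text \<open>Both differences share the factor 1 - 2 * X, so their quotient is X * (1 - X) times the
  ratio of consecutive central binomial coefficients. The factor \<open>Suc k\<close> clears the
  denominator of that ratio.\<close>

lemma rosenfeld_poly_recurrence:
  "of_nat (Suc k) * (rosenfeld_poly (Suc (Suc k)) - rosenfeld_poly (Suc k)) =
    2 * (2 * of_nat k + 1) * (X * (1 - X)) * (rosenfeld_poly (Suc k) - rosenfeld_poly k)"
proof -
  have c: "(of_nat (Suc k) * of_nat ((2 * Suc k) choose Suc k) :: real poly) =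
      2 * (2 * of_nat k + 1) * of_nat ((2 * k) choose k)"
    using arg_cong[OF central_binomial_Suc[of k], of "of_nat :: nat \<Rightarrow> real poly"]
    by (simp only: of_nat_mult of_nat_add of_nat_1 of_nat_numeral)
  have alg: "a * - (b * (s * t) * u) = - ((a * b) * s * t * u)"
    "2 * d * s * - (g * t * u) = - ((2 * d * g) * s * t * u)"
    for a b d g s t u :: "real poly"
    by (simp_all add: mult_ac)
  show ?thesis
    unfolding rosenfeld_poly_diff power_Suc alg c ..
qed

theorem theorem1:
  "rosenfeld_poly 0 = 1 \<and>
   rosenfeld_poly 1 = 2 * X \<and>
   (\<forall>n::nat. n \<ge> 2 \<longrightarrow>
      rosenfeld_poly n =
        - smult (1 / (real n - 1))
            (4 * of_nat n * X ^ 2 - 4 * X * of_nat n - 6 * X ^ 2 - of_nat n + 6 * X + 1)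
          * rosenfeld_poly (n - 1)
        + smult (1 / (real n - 1)) (2 * X * (X - 1) * (2 * of_nat n - 3))
          * rosenfeld_poly (n - 2))"
proof (intro conjI allI impI)
  show r0: "rosenfeld_poly 0 = 1"
    by (simp add: rosenfeld_poly_def)
  show "rosenfeld_poly 1 = 2 * X"
    using rosenfeld_poly_diff[of 0] r0 by (simp add: algebra_simps)
  fix n :: nat
  assume "n \<ge> 2"
  then obtain k where n: "n = Suc (Suc k)"
    by (metis add_2_eq_Suc le_Suc_ex)
  define K where "K = (of_nat k :: real poly)"
  \<comment> \<open>An opaque name lets the simplifier treat the indeterminate as an atom instead of
    computing with its coefficient list.\<close>
  define x where "x = X"
  let ?A = "rosenfeld_poly (Suc k)" and ?B = "rosenfeld_poly k"
  let ?P = "4 * of_nat n * x ^ 2 - 4 * x * of_nat n - 6 * x ^ 2 - of_nat n + 6 * x + 1"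
  let ?Q = "2 * x * (x - 1) * (2 * of_nat n - 3)"
  have nK: "of_nat n = K + 2"
    by (simp add: n K_def)
  have "smult (real n - 1) (rosenfeld_poly n) = of_nat (Suc k) * rosenfeld_poly n"
    by (simp add: n of_nat_poly)
  also have "\<dots> = (K + 1) * ?A + 2 * (2 * K + 1) * (x * (1 - x)) * (?A - ?B)"
    using rosenfeld_poly_recurrence[of k, folded x_def] unfolding n
    by (simp add: K_def algebra_simps)
  \<comment> \<open>With n = K + 2, the factor 2 * n - 3 is 2 * K + 1, and - \<open>?P\<close> is K
    + 1 + 2 * (2 * K + 1) * x * (1 - x).\<close>
  also have "\<dots> = - ?P * ?A + ?Q * ?B"
    unfolding nK by (simp add: algebra_simps power2_eq_square)
  finally have "smult (1 / (real n - 1)) (smult (real n - 1) (rosenfeld_poly n)) =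
      smult (1 / (real n - 1)) (- ?P * ?A + ?Q * ?B)"
    by (rule arg_cong)
  moreover have "smult c (- P * A + Q * B) = - smult c P * A + smult c Q * B"
    for c :: real and P Q A B
    by (simp add: smult_diff_right)
  \<comment> \<open>The scalars cancel because n \<ge> 2 makes \<open>real n - 1\<close>
    nonzero.\<close>
  ultimately have "rosenfeld_poly n =
      - smult (1 / (real n - 1)) ?P * ?A + smult (1 / (real n - 1)) ?Q * ?B"
    using \<open>n \<ge> 2\<close> by (simp only: smult_smult) simp
  moreover have "n - 1 = Suc k" "n - 2 = k"
    by (simp_all add: n)
  ultimately show "rosenfeld_poly n =
        - smult (1 / (real n - 1))
            (4 * of_nat n * X ^ 2 - 4 * X * of_nat n - 6 * X ^ 2 - of_nat n + 6 * X + 1)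
          * rosenfeld_poly (n - 1)
        + smult (1 / (real n - 1)) (2 * X * (X - 1) * (2 * of_nat n - 3))
          * rosenfeld_poly (n - 2)"
    by (simp only: x_def)
qed

end
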